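(* Let $G=(V,q)$ be a finite graph satisfying $CD(0,n)$ for some $n<\infty$. Let $u_0\in C(V)$ satisfy $\|\Gamma u_0\|_\infty\le q_{\min}/2$, and let $(u_t)_{t\ge 0}$ be the solution of $\partial_t u_t=\Delta u_t+\Gamma u_t$ with initial value $u_0$. Then for all $t>0$, pointwise on $V$, $$\Gamma u_t-\partial_t u_t=-\Delta u_t\le\frac{n}{2t}.$$
   Context: A finite graph $G=(V,q)$ consists of a finite set $V$ and a function $q:V^2\to[0,\infty)$ with $q(x,x)=0$ for all $x\in V$ ($q$ need not be symmetric). Put $q_{\min}:=\min\{q(x,y):x,y\in V,\ q(x,y)>0\}$ (this presupposes that $q$ is not identically zero). $C(V)=\mathbb{R}^V$, and $\|f\|_\infty=\sup_{x\in V}|f(x)|$. The Laplacian is $\Delta f(x)=\sum_{y}q(x,y)(f(y)-f(x))$. The operators $\Gamma_k:C(V)\times C(V)\to C(V)$ are defined by $\Gamma_0(f,g)=fg$ and $2\Gamma_{k+1}(f,g)=\Delta\Gamma_k(f,g)-\Gamma_k(f,\Delta g)-\Gamma_k(\Delta f,g)$; write $\Gamma_k f=\Gamma_k(f,f)$ and $\Gamma=\Gamma_1$, so $\Gamma f(x)=\frac12\sum_y q(x,y)(f(y)-f(x))^2$. $G$ satisfies $CD(K,n)$ (with $K\in\mathbb{R}$, $n\in(0,\infty]$, $1/\infty=0$) if $\Gamma_2 f\ge\frac1n(\Delta f)^2+K\,\Gamma f$ pointwise on $V$ for all $f\in C(V)$. The ODE system $\partial_t u_t=\Delta u_t+\Gamma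 u_t$ has a unique maximal solution for each initial value $u_0$; if $G$ satisfies $CD(0,\infty)$ (in particular under $CD(0,n)$) and $\|\Gamma u_0\|_\infty\le q_{\min}/2$, it exists for all $t\ge 0$. *)

theory Defs
  imports "HOL-Analysis.Analysis"
begin

locale finite_graph =
  fixes q :: "'v::finite \<Rightarrow> 'v \<Rightarrow> real"
  assumes q_nonneg: "0 \<le> q x y"
    and q_diag: "q x x = 0"

(* Unspecified when q is identically zero, since then the set is empty. *)
definition q_min :: "('v::finite \<Rightarrow> 'v \<Rightarrow> real) \<Rightarrow> real" where
  "q_min q = Min {q x y | x y. 0 < q x y}"

definition sup_norm :: "('v::finite \<Rightarrow> real) \<Rightarrow> real" where
  "sup_norm f = (SUP x. \<bar>f x\<bar>)"

definition Laplacian :: "('v::finite \<Rightarrow> 'v \<Rightarrow> real) \<Rightarrow> ('v \<Rightarrow> real) \<Rightarrow> 'v \<Rightarrow> real" where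
  "Laplacian q f x = (\<Sum>y\<in>UNIV. q x y * (f y - f x))"

primrec Gamma_iter ::
  "('v::finite \<Rightarrow> 'v \<Rightarrow> real) \<Rightarrow> nat \<Rightarrow> ('v \<Rightarrow> real) \<Rightarrow> ('v \<Rightarrow> real) \<Rightarrow> 'v \<Rightarrow> real" where
  "Gamma_iter q 0 = (\<lambda>f g x. f x * g x)"
| "Gamma_iter q (Suc k) = (\<lambda>f g x.
     (Laplacian q (Gamma_iter q k f g) x
       - Gamma_iter q k f (Laplacian q g) x
       - Gamma_iter q k (Laplacian q f) g x) / 2)"

abbreviation \<Gamma> :: "('v::finite \<Rightarrow> 'v \<Rightarrow> real) \<Rightarrow> ('v \<Rightarrow> real) \<Rightarrow> 'v \<Rightarrow> real" where
  "\<Gamma> q f \<equiv> Gamma_iter q 1 f f"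

abbreviation \<Gamma>2 :: "('v::finite \<Rightarrow> 'v \<Rightarrow> real) \<Rightarrow> ('v \<Rightarrow> real) \<Rightarrow> 'v \<Rightarrow> real" where
  "\<Gamma>2 q f \<equiv> Gamma_iter q 2 f f"

lemma Gamma_eq:
  "\<Gamma> q f x = (\<Sum>y\<in>UNIV. q x y * (f y - f x)\<^sup>2) / 2"
proof -
  have "2 * \<Gamma> q f x
      = (\<Sum>y\<in>UNIV. q x y * (f y * f y - f x * f x))
        - f x * Laplacian q f x - Laplacian q f x * f x"
    by (simp add: Laplacian_def)
  also have "\<dots> = (\<Sum>y\<in>UNIV. q x y * (f y * f y - f x * f x)
          - f x * (q x y * (f y - f x)) - q x y * (f y - f x) * f x)"
    by (simp only: Laplacian_def sum_subtractf sum_distrib_left sum_distrib_right)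
  also have "\<dots> = (\<Sum>y\<in>UNIV. q x y * (f y - f x)\<^sup>2)"
    by (rule sum.cong) (simp_all add: algebra_simps power2_eq_square)
  finally show ?thesis by simp
qed

(* Meant for 0 < n; in ereal, 1 / \<infinity> = 0. *)
definition CD :: "('v::finite \<Rightarrow> 'v \<Rightarrow> real) \<Rightarrow> real \<Rightarrow> ereal \<Rightarrow> bool" where
  "CD q K n \<longleftrightarrow>
     (\<forall>f x. \<Gamma>2 q f x \<ge> real_of_ereal (1 / n) * (Laplacian q f x)\<^sup>2 + K * \<Gamma> q f x)"

(* Global solutions of u' = \<Delta>u + \<Gamma>u on [0, \<infinity>), with the one-sided derivative at t = 0. *)
definition is_solution ::
  "('v::finite \<Rightarrow> 'v \<Rightarrow> real) \<Rightarrow> ('v \<Rightarrow> real) \<Rightarrow> (real \<Rightarrow> 'v \<Rightarrow> real) \<Rightarrow> bool" where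
  "is_solution q u0 u \<longleftrightarrow> u 0 = u0 \<and>
     (\<forall>t\<ge>0. \<forall>x. ((\<lambda>s. u s x) has_real_derivative Laplacian q (u t) x + \<Gamma> q (u t) x)
        (at t within {0..}))"

end

theory Submission
  imports Defs
begin

text \<open>
  Put \<open>\<Delta>\<^sub>u g = \<Delta> g + 2 \<Gamma>(u, g)\<close>, i.e.
  \<open>\<Delta>\<^sub>u g(x) = (\<Sum>y. q(x,y) (1 + u(y) - u(x)) (g(y) - g(x)))\<close>. Along the flow,
  \<open>\<partial>\<^sub>t \<Gamma> u = \<Delta>\<^sub>u \<Gamma> u - 2 \<Gamma>\<^sub>2 u\<close> and \<open>\<partial>\<^sub>t \<Delta> u = \<Delta>\<^sub>u \<Delta> u + 2 \<Gamma>\<^sub>2 u\<close>.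
  As long as \<open>\<Gamma> u \<le> q\<^sub>m\<^sub>i\<^sub>n / 2\<close>, the weights of \<open>\<Delta>\<^sub>u\<close> are nonnegative, so
  \<open>\<Delta>\<^sub>u\<close> obeys the maximum principle. The first equation then shows that this bound on \<open>\<Gamma> u\<close>
  persists; by the second one and \<open>CD(0,n)\<close>, the minimum \<open>w\<close> of \<open>\<Delta> u\<close> satisfies
  \<open>w' \<ge> 2 w\<^sup>2 / n\<close>, whence \<open>w \<ge> - n / (2 t)\<close>.
\<close>

section \<open>Maximum principle on a finite vertex set\<close>

text \<open>If \<open>h\<close> were positive somewhere, damping by
  \<open>exp (- (C + 1) * s)\<close> would make the time derivative strictly negative at a positive
  space-time maximum, contradicting larger values just before. Hence growth linear in
  \<open>h\<close> is harmless, and only spatial maxima need testing.\<close>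

lemma max_principle_finite:
  fixes h :: "real \<Rightarrow> 'v::finite \<Rightarrow> real"
  assumes deriv: "\<And>t x. 0 \<le> t \<Longrightarrow> t \<le> T \<Longrightarrow>
      ((\<lambda>s. h s x) has_real_derivative D t x) (at t within {0..T})"
    and init: "\<And>x. h 0 x \<le> 0"
    and max: "\<And>t x. 0 < t \<Longrightarrow> t \<le> T \<Longrightarrow> 0 < h t x \<Longrightarrow> (\<And>y. h t y \<le> h t x) \<Longrightarrow>
      D t x \<le> C * h t x"
    and t: "0 \<le> t" "t \<le> T"
  shows "h t x \<le> 0"
proof (rule ccontr)
  assume "\<not> h t x \<le> 0"
  then have pos: "0 < h t x" by simp
  define k where "k s y = exp (- (C + 1) * s) * h s y" for s y
  have dk: "((\<lambda>s. k s y) has_real_derivative exp (- (C + 1) * s) * (D s y - (C + 1) * h s y))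
      (at s within {0..T})" if "0 \<le> s" "s \<le> T" for s y
    unfolding k_def
    by (rule derivative_eq_intros deriv[OF that] refl)+ (simp add: algebra_simps)
  have "continuous_on {0..T} (\<lambda>s. k s y)" for y
    by (rule DERIV_continuous_on[OF dk]) auto
  then have "\<exists>s\<in>{0..T}. \<forall>r\<in>{0..T}. k r y \<le> k s y" for y
    using t by (intro continuous_attains_sup) auto
  then obtain \<tau> where \<tau>: "\<tau> y \<in> {0..T}" "r \<in> {0..T} \<Longrightarrow> k r y \<le> k (\<tau> y) y" for y r
    by metis
  have "Max (range (\<lambda>y. k (\<tau> y) y)) \<in> range (\<lambda>y. k (\<tau> y) y)"
    by (intro Max_in) auto
  then obtain z where z: "Max (range (\<lambda>y. k (\<tau> y) y)) = k (\<tau> z) z"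
    by (elim rangeE)
  have k_le: "k r y \<le> k (\<tau> z) z" if "r \<in> {0..T}" for r y
  proof -
    have "k (\<tau> y) y \<le> Max (range (\<lambda>y. k (\<tau> y) y))"
      by (intro Max_ge) auto
    with \<tau>(2)[OF that, of y] z show ?thesis by simp
  qed
  have "0 < k t x" using pos by (simp add: k_def)
  also have "\<dots> \<le> k (\<tau> z) z" using t by (intro k_le) auto
  finally have hz: "0 < h (\<tau> z) z" by (simp add: k_def zero_less_mult_iff)
  with init[of z] \<tau>(1)[of z] have \<tau>z: "0 < \<tau> z" "\<tau> z \<le> T"
    by (auto simp: less_le)
  have "h (\<tau> z) y \<le> h (\<tau> z) z" for y
    using k_le[OF \<tau>(1)[of z], of y] by (simp add: k_def)
  from max[OF \<tau>z hz this] have "D (\<tau> z) z - (C + 1) * h (\<tau> z) z < 0"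
    using hz by (simp add: algebra_simps)
  then have neg: "exp (- (C + 1) * \<tau> z) * (D (\<tau> z) z - (C + 1) * h (\<tau> z) z) < 0"
    by (simp add: mult_pos_neg)
  \<comment> \<open>Looking only to the left of \<open>\<tau> z\<close> also covers a maximum at the
    endpoint \<open>T\<close>.\<close>
  obtain d where d: "0 < d"
    "\<And>e. 0 < e \<Longrightarrow> \<tau> z - e \<in> {0..T} \<Longrightarrow> e < d \<Longrightarrow> k (\<tau> z) z < k (\<tau> z - e) z"
    using has_real_derivative_neg_dec_left[OF dk neg] \<tau>z by auto
  define e where "e = min (d / 2) (\<tau> z)"
  have "0 < e" "e < d" "\<tau> z - e \<in> {0..T}"
    using d(1) \<tau>z by (auto simp: e_def)
  with d(2) k_le[of "\<tau> z - e" z] show False by force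
qed

section \<open>Bilinear calculus of the Gamma operators\<close>

declare Gamma_iter.simps [simp del]

lemma Gamma_bilinear:
  "Gamma_iter q 1 f g x = (\<Sum>y\<in>UNIV. q x y * ((f y - f x) * (g y - g x))) / 2"
proof -
  have "2 * Gamma_iter q 1 f g x
      = (\<Sum>y\<in>UNIV. q x y * (f y * g y - f x * g x))
        - f x * Laplacian q g x - Laplacian q f x * g x"
    by (simp add: Laplacian_def Gamma_iter.simps)
  also have "\<dots> = (\<Sum>y\<in>UNIV. q x y * (f y * g y - f x * g x)
          - f x * (q x y * (g y - g x)) - q x y * (f y - f x) * g x)"
    by (simp only: Laplacian_def sum_subtractf sum_distrib_left sum_distrib_right)
  also have "\<dots> = (\<Sum>y\<in>UNIV. q x y * ((f y - f x) * (g y - g x)))"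
    by (rule sum.cong) (simp_all add: algebra_simps)
  finally show ?thesis by simp
qed

lemma Gamma_commute: "Gamma_iter q 1 f g = Gamma_iter q 1 g f"
  by (rule ext) (simp only: Gamma_bilinear mult.commute mult.left_commute)

lemma Gamma_add_right:
  "Gamma_iter q 1 f (\<lambda>x. g x + h x) x = Gamma_iter q 1 f g x + Gamma_iter q 1 f h x"
  by (simp only: Gamma_bilinear flip: sum.distrib add_divide_distrib)
    (simp add: algebra_simps)

lemma Laplacian_add:
  "Laplacian q (\<lambda>x. g x + h x) x = Laplacian q g x + Laplacian q h x"
  by (simp add: Laplacian_def algebra_simps sum.distrib sum_subtractf)

lemma Gamma2_eq:
  "2 * \<Gamma>2 q f x = Laplacian q (\<Gamma> q f) x - 2 * Gamma_iter q 1 f (Laplacian q f) x"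
proof -
  have "\<Gamma>2 q f x = (Laplacian q (\<Gamma> q f) x - Gamma_iter q 1 f (Laplacian q f) x
      - Gamma_iter q 1 (Laplacian q f) f x) / 2"
    unfolding One_nat_def numeral_2_eq_2 Gamma_iter.simps(2) by (rule refl)
  then show ?thesis
    unfolding Gamma_commute[of q "Laplacian q f" f] by simp
qed

lemma drift_Laplacian_eq:
  "Laplacian q g x + 2 * Gamma_iter q 1 u g x
    = (\<Sum>y\<in>UNIV. q x y * (1 + u y - u x) * (g y - g x))"
  by (simp only: Gamma_bilinear Laplacian_def) (simp add: algebra_simps flip: sum.distrib)

lemma q_min_pos: "\<exists>x y. 0 < q x y \<Longrightarrow> 0 < q_min q"
  and q_min_le: "0 < q x y \<Longrightarrow> q_min q \<le> q x y"
proof -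
  have "finite ((\<lambda>(x, y). q x y) ` UNIV)" by (rule finite_imageI) simp
  then have fin: "finite {q x y | x y. 0 < q x y}"
    by (rule rev_finite_subset) auto
  show "0 < q_min q" if "\<exists>x y. 0 < q x y"
    using Min_in[OF fin] that unfolding q_min_def by auto
  show "q_min q \<le> q x y" if "0 < q x y"
    unfolding q_min_def using that by (intro Min_le fin) auto
qed

lemma le_sup_norm: "f x \<le> sup_norm f"
proof -
  have "\<bar>f x\<bar> \<le> sup_norm f"
    unfolding sup_norm_def by (rule cSUP_upper) auto
  then show ?thesis by simp
qed

section \<open>Sign of the drift Laplacian at extrema\<close>

context finite_graph
begin

lemma Gamma_nonneg: "0 \<le> \<Gamma> q f x"
  unfolding Gamma_eq by (intro divide_nonneg_pos sum_nonneg mult_nonneg_nonneg q_nonneg) auto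

text \<open>
  Linear in \<open>\<Gamma> q u x\<close>, because of \<open>1 + s \<ge> (1 - s\<^sup>2) / 2\<close>. This linear loss
  is what a Gronwall argument can absorb in the borderline case \<open>\<Gamma> u = q\<^sub>m\<^sub>i\<^sub>n / 2\<close>.
\<close>
lemma drift_weight_lower:
  assumes "0 < q x y"
  shows "(1 - \<Gamma> q u x / (q_min q / 2)) / 2 \<le> 1 + u y - u x"
proof -
  let ?s = "u y - u x"
  have m: "0 < q_min q" using assms by (intro q_min_pos) auto
  have "q_min q * ?s\<^sup>2 \<le> q x y * ?s\<^sup>2"
    using assms by (intro mult_right_mono q_min_le) auto
  also have "\<dots> \<le> (\<Sum>y\<in>UNIV. q x y * (u y - u x)\<^sup>2)"
    by (rule member_le_sum[of y UNIV "\<lambda>y. q x y * (u y - u x)\<^sup>2"]) (auto simp: q_nonneg)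
  also have "\<dots> = 2 * \<Gamma> q u x" unfolding Gamma_eq by simp
  finally have "?s\<^sup>2 \<le> \<Gamma> q u x / (q_min q / 2)"
    using m by (simp add: field_simps)
  moreover have "0 \<le> (1 + ?s)\<^sup>2" by simp
  then have "(1 - ?s\<^sup>2) / 2 \<le> 1 + ?s" by (simp add: power2_sum)
  ultimately show ?thesis by simp
qed

text \<open>Above the threshold a weight may be negative, but only by an amount proportional to the
  excess \<open>\<Gamma> q u x - q_min q / 2\<close>. The result is therefore of the linear form
  that \<open>max_principle_finite\<close> tolerates.\<close>

lemma drift_Laplacian_at_max_le:
  assumes max: "\<And>y. \<Gamma> q u y \<le> \<Gamma> q u x"
    and large: "q_min q / 2 < \<Gamma> q u x" and m: "0 < q_min q"
  shows "Laplacian q (\<Gamma> q u) x + 2 * Gamma_iter q 1 u (\<Gamma> q u) x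
    \<le> (\<Sum>y\<in>UNIV. q x y) * \<Gamma> q u x / q_min q * (\<Gamma> q u x - q_min q / 2)"
proof -
  let ?g = "\<Gamma> q u" and ?m = "q_min q"
  have "q x y * (1 + u y - u x) * (?g y - ?g x) \<le> q x y * (?g x / ?m * (?g x - ?m / 2))" for y
  proof (cases "q x y = 0")
    case False
    then have qpos: "0 < q x y" using q_nonneg[of x y] by simp
    \<comment> \<open>\<open>- \<delta>\<close> is exactly the lower bound of
      \<open>drift_weight_lower\<close>, rewritten.\<close>
    define \<delta> where "\<delta> = (?g x - ?m / 2) / ?m"
    have "\<delta> > 0" using large m by (simp add: \<delta>_def)
    have "- \<delta> \<le> 1 + u y - u x"
      using drift_weight_lower[OF qpos, of u] m by (simp add: \<delta>_def field_simps)
    then have "(1 + u y - u x) * (?g y - ?g x) \<le> - \<delta> * (?g y - ?g x)"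
      using max[of y] by (intro mult_right_mono_neg) (auto)
    \<comment> \<open>The term \<open>- \<delta> * ?g y\<close> is dropped, as
      \<open>\<Gamma>\<close> is nonnegative.\<close>
    also have "\<dots> \<le> \<delta> * ?g x"
      using Gamma_nonneg[of u y] \<open>\<delta> > 0\<close>
      by (simp add: algebra_simps)
    also have "\<dots> = ?g x / ?m * (?g x - ?m / 2)" by (simp add: \<delta>_def)
    finally show ?thesis
      unfolding mult.assoc[of "q x y"] by (rule mult_left_mono) (rule q_nonneg)
  qed simp
  then have "(\<Sum>y\<in>UNIV. q x y * (1 + u y - u x) * (?g y - ?g x))
      \<le> (\<Sum>y\<in>UNIV. q x y * (?g x / ?m * (?g x - ?m / 2)))"
    by (rule sum_mono)
  also have "\<dots> = (\<Sum>y\<in>UNIV. q x y) * ?g x / ?m * (?g x - ?m / 2)"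
    unfolding sum_distrib_right[symmetric] by simp
  finally show ?thesis unfolding drift_Laplacian_eq .
qed

lemma drift_Laplacian_at_min_nonneg:
  assumes min: "\<And>y. w x \<le> w y" and bound: "\<Gamma> q u x \<le> q_min q / 2"
  shows "0 \<le> Laplacian q w x + 2 * Gamma_iter q 1 u w x"
  unfolding drift_Laplacian_eq
proof (intro sum_nonneg)
  fix y
  show "0 \<le> q x y * (1 + u y - u x) * (w y - w x)"
  proof (cases "q x y = 0")
    case False
    then have qpos: "0 < q x y" using q_nonneg[of x y] by simp
    then have "0 < q_min q" by (intro q_min_pos) auto
    then have "0 \<le> (1 - \<Gamma> q u x / (q_min q / 2)) / 2"
      using bound by (simp add: field_simps)
    also note drift_weight_lower[OF qpos]
    finally show ?thesis using qpos min[of y] by simp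
  qed simp
qed

end

section \<open>Evolution equations along the flow\<close>

lemma has_real_derivative_Laplacian:
  assumes "\<And>x. ((\<lambda>s. u s x) has_real_derivative v x) (at t within S)"
  shows "((\<lambda>s. Laplacian q (u s) x) has_real_derivative Laplacian q v x) (at t within S)"
  unfolding Laplacian_def
  by (rule derivative_eq_intros assms refl)+ (simp add: mult.commute)

lemma has_real_derivative_Gamma:
  assumes "\<And>x. ((\<lambda>s. u s x) has_real_derivative v x) (at t within S)"
  shows "((\<lambda>s. \<Gamma> q (u s) x) has_real_derivative 2 * Gamma_iter q 1 (u t) v x) (at t within S)"
proof -
  have "((\<lambda>s. q x y * ((u s y - u s x) * (u s y - u s x))) has_real_derivative
      2 * (q x y * ((u t y - u t x) * (v y - v x)))) (at t within S)" for y
    by (rule derivative_eq_intros assms refl)+ (simp add: algebra_simps)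
  then have "((\<lambda>s. (\<Sum>y\<in>UNIV. q x y * ((u s y - u s x) * (u s y - u s x))) / 2)
      has_real_derivative (\<Sum>y\<in>UNIV. 2 * (q x y * ((u t y - u t x) * (v y - v x)))) / 2)
      (at t within S)"
    by (intro DERIV_cdivide DERIV_sum)
  then show ?thesis
    unfolding Gamma_bilinear sum_distrib_left[symmetric] by simp
qed

text \<open>Linearity gives the Laplacian of \<open>\<Delta>u + \<Gamma>u\<close>;
  \<open>Gamma2_eq\<close> then trades \<open>\<Delta>\<Gamma>u\<close> for twice
  \<open>\<Gamma>2\<close> plus the drift term.\<close>

lemma is_solution_Laplacian_deriv:
  assumes "is_solution q u0 u" "0 \<le> t"
  shows "((\<lambda>s. Laplacian q (u s) x) has_real_derivative
    Laplacian q (Laplacian q (u t)) x + 2 * Gamma_iter q 1 (u t) (Laplacian q (u t)) x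
      + 2 * \<Gamma>2 q (u t) x) (at t within {0..})"
proof -
  have "((\<lambda>s. u s y) has_real_derivative Laplacian q (u t) y + \<Gamma> q (u t) y) (at t within {0..})"
    for y using assms unfolding is_solution_def by blast
  from has_real_derivative_Laplacian[where u = u and q = q and x = x, OF this] show ?thesis
    unfolding Gamma2_eq Laplacian_add by (rule DERIV_cong) simp
qed

text \<open>Here \<open>Gamma2_eq\<close> is used the other way: the mixed term of \<open>u\<close>
  with \<open>\<Delta>u\<close> becomes \<open>\<Delta>\<Gamma>u\<close> minus twice
  \<open>\<Gamma>2\<close>.\<close>

lemma is_solution_Gamma_deriv:
  assumes "is_solution q u0 u" "0 \<le> t"
  shows "((\<lambda>s. \<Gamma> q (u s) x) has_real_derivative
    Laplacian q (\<Gamma> q (u t)) x + 2 * Gamma_iter q 1 (u t) (\<Gamma> q (u t)) x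
      - 2 * \<Gamma>2 q (u t) x) (at t within {0..})"
proof -
  have "((\<lambda>s. u s y) has_real_derivative Laplacian q (u t) y + \<Gamma> q (u t) y) (at t within {0..})"
    for y using assms unfolding is_solution_def by blast
  from has_real_derivative_Gamma[where u = u and q = q and x = x, OF this] show ?thesis
    unfolding Gamma2_eq Gamma_add_right by (rule DERIV_cong) simp
qed

section \<open>Persistence of the gradient bound and decay of the Laplacian\<close>

lemma CD_zero_Gamma2_ge:
  assumes "CD q 0 (ereal n)" "0 < n"
  shows "(Laplacian q f x)\<^sup>2 / n \<le> \<Gamma>2 q f x"
proof -
  have "real_of_ereal (1 / ereal n) = 1 / n"
    using assms(2) by (simp add: one_ereal_def)
  moreover have "real_of_ereal (1 / ereal n) * (Laplacian q f x)\<^sup>2 + 0 * \<Gamma> q f x \<le> \<Gamma>2 q f x"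
    using assms(1) unfolding CD_def by blast
  ultimately show ?thesis by simp
qed

lemma (in finite_graph) is_solution_Gamma_le:
  assumes Gamma2_nonneg: "\<And>f x. 0 \<le> \<Gamma>2 q f x"
    and m: "0 < q_min q"
    and init: "\<And>x. \<Gamma> q u0 x \<le> q_min q / 2"
    and sol: "is_solution q u0 u" and T: "0 \<le> T"
  shows "\<Gamma> q (u T) x \<le> q_min q / 2"
proof -
  let ?G = "\<lambda>t x. \<Gamma> q (u t) x"
  note dG = DERIV_subset[OF is_solution_Gamma_deriv[OF sol], of _ "{0..T}"]
  \<comment> \<open>The growth rate in \<open>drift_Laplacian_at_max_le\<close> still contains
    \<open>\<Gamma>\<close>. Compactness of \<open>{0..T}\<close> bounds the sum over all vertices,
    hence each nonnegative summand, and so yields a constant \<open>C\<close>.\<close>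
  have "continuous_on {0..T} (\<lambda>t. \<Sum>x\<in>UNIV. ?G t x)"
    by (intro continuous_on_sum DERIV_continuous_on[OF dG]) auto
  then obtain r where r: "\<And>t. t \<in> {0..T} \<Longrightarrow> (\<Sum>x\<in>UNIV. ?G t x) \<le> (\<Sum>x\<in>UNIV. ?G r x)"
    using continuous_attains_sup[of "{0..T}"] T by fastforce
  define B where "B = (\<Sum>x\<in>UNIV. ?G r x)"
  define Q where "Q = (\<Sum>x\<in>UNIV. \<Sum>y\<in>UNIV. q x y)"
  have G_le: "?G t x \<le> B" if "t \<in> {0..T}" for t x
    unfolding B_def
    using member_le_sum[of x UNIV "?G t"] r[OF that] Gamma_nonneg[of "u t"] by simp
  have Q_ge: "(\<Sum>y\<in>UNIV. q x y) \<le> Q" for x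
    unfolding Q_def
    by (rule member_le_sum[of x UNIV "\<lambda>x. \<Sum>y\<in>UNIV. q x y"]) (auto intro: sum_nonneg q_nonneg)
  have "?G T x - q_min q / 2 \<le> 0"
  proof (rule max_principle_finite[where T = T and C = "Q * B / q_min q"
        and h = "\<lambda>t x. ?G t x - q_min q / 2"])
    fix t x assume t: "0 \<le> t" "t \<le> T"
    show "((\<lambda>s. ?G s x - q_min q / 2) has_real_derivative
        Laplacian q (?G t) x + 2 * Gamma_iter q 1 (u t) (?G t) x - 2 * \<Gamma>2 q (u t) x)
        (at t within {0..T})"
      using DERIV_diff[OF dG DERIV_const, of t x "q_min q / 2"] t by simp
  next
    show "?G 0 x - q_min q / 2 \<le> 0" for x
      using init[of x] sol by (simp add: is_solution_def)
  next
    fix t x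
    assume t: "0 < t" "t \<le> T" and pos: "0 < ?G t x - q_min q / 2"
      and max: "\<And>y. ?G t y - q_min q / 2 \<le> ?G t x - q_min q / 2"
    have "Laplacian q (?G t) x + 2 * Gamma_iter q 1 (u t) (?G t) x - 2 * \<Gamma>2 q (u t) x
        \<le> (\<Sum>y\<in>UNIV. q x y) * ?G t x / q_min q * (?G t x - q_min q / 2)"
      using drift_Laplacian_at_max_le[of "u t" x] max pos m Gamma2_nonneg[of "u t" x]
      by simp
    also have "\<dots> \<le> Q * B / q_min q * (?G t x - q_min q / 2)"
    proof (intro mult_right_mono divide_right_mono mult_mono Q_ge)
      show "?G t x \<le> B" using t by (intro G_le) auto
      show "0 \<le> Q" unfolding Q_def by (intro sum_nonneg q_nonneg)
      show "0 \<le> ?G t x" by (rule Gamma_nonneg)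
    qed (use m pos in \<open>auto\<close>)
    finally show "Laplacian q (?G t) x + 2 * Gamma_iter q 1 (u t) (?G t) x - 2 * \<Gamma>2 q (u t) x
        \<le> Q * B / q_min q * (?G t x - q_min q / 2)" .
  qed (use T in auto)
  then show ?thesis by simp
qed

text \<open>
  The maximum principle is applied to \<open>- t \<Delta> u - n / 2\<close>, which avoids both the singularity of
  \<open>n / (2 t)\<close> at \<open>t = 0\<close> and the differentiation of the minimum of \<open>\<Delta> u\<close>.
\<close>
lemma (in finite_graph) is_solution_Laplacian_ge:
  assumes CD: "\<And>f x. (Laplacian q f x)\<^sup>2 / n \<le> \<Gamma>2 q f x" and n: "0 < n"
    and bound: "\<And>t x. 0 \<le> t \<Longrightarrow> \<Gamma> q (u t) x \<le> q_min q / 2"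
    and sol: "is_solution q u0 u" and T: "0 < T"
  shows "- Laplacian q (u T) x \<le> n / (2 * T)"
proof -
  let ?w = "\<lambda>t. Laplacian q (u t)"
  define W where "W t x = Laplacian q (?w t) x + 2 * Gamma_iter q 1 (u t) (?w t) x
      + 2 * \<Gamma>2 q (u t) x" for t x
  have "- T * ?w T x - n / 2 \<le> 0"
  proof (rule max_principle_finite[where T = T and C = 0 and h = "\<lambda>t x. - t * ?w t x - n / 2"])
    fix t x assume t: "0 \<le> t" "t \<le> T"
    have dw: "((\<lambda>s. ?w s x) has_real_derivative W t x) (at t within {0..T})"
      unfolding W_def
      by (rule DERIV_subset[OF is_solution_Laplacian_deriv[OF sol t(1)]]) auto
    show "((\<lambda>s. - s * ?w s x - n / 2) has_real_derivative - ?w t x - t * W t x)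
        (at t within {0..T})"
      by (rule derivative_eq_intros dw refl)+ simp
  next
    show "- 0 * ?w 0 x - n / 2 \<le> 0" for x using n by simp
  next
    fix t x
    assume t: "0 < t" "t \<le> T" and pos: "0 < - t * ?w t x - n / 2"
      and max: "\<And>y. - t * ?w t y - n / 2 \<le> - t * ?w t x - n / 2"
    have "?w t x \<le> ?w t y" for y using max[of y] t by simp
    then have "0 \<le> Laplacian q (?w t) x + 2 * Gamma_iter q 1 (u t) (?w t) x"
      using t by (intro drift_Laplacian_at_min_nonneg bound) auto
    with CD[of "u t" x] have "2 * ((?w t x)\<^sup>2 / n) \<le> W t x" unfolding W_def by linarith
    then have "- ?w t x - t * W t x \<le> - ?w t x - t * (2 * ((?w t x)\<^sup>2 / n))"
      using t by (intro diff_left_mono mult_left_mono) auto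
    \<comment> \<open>The quadratic term of the curvature bound makes the tested function itself a
      factor; it is positive here, which forces \<open>?w t x\<close> to be negative.\<close>
    also have "\<dots> = ?w t x * (2 / n) * (- t * ?w t x - n / 2)"
      using n by (simp add: field_simps power2_eq_square)
    also have "\<dots> \<le> 0"
    proof (rule mult_nonpos_nonneg)
      have "t * ?w t x < 0" using pos n by simp
      then have "?w t x < 0" using t by (simp add: mult_less_0_iff)
      then show "?w t x * (2 / n) \<le> 0" using n by (intro mult_nonpos_nonneg) auto
    qed (use pos in simp)
    finally show "- ?w t x - t * W t x \<le> 0 * (- t * ?w t x - n / 2)" by simp
  qed (use T in auto)
  then show ?thesis using T by (simp add: field_simps)
qed

theorem theorem3p1:
  fixes q :: "'v::finite \<Rightarrow> 'v \<Rightarrow> real"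
    and n :: real
    and u0 :: "'v \<Rightarrow> real"
    and u :: "real \<Rightarrow> 'v \<Rightarrow> real"
  assumes "finite_graph q"
    and "\<exists>x y. q x y > 0"
    and "n > 0"
    and "CD q 0 (ereal n)"
    and "sup_norm (\<Gamma> q u0) \<le> q_min q / 2"
    and "is_solution q u0 u"
  shows "\<forall>t>0. \<forall>x.
    \<Gamma> q (u t) x - deriv (\<lambda>s. u s x) t = - Laplacian q (u t) x \<and>
    - Laplacian q (u t) x \<le> n / (2 * t)"
proof (intro allI impI conjI)
  interpret finite_graph q by fact
  \<comment> \<open>The curvature bound enters twice: as mere nonnegativity of
    \<open>\<Gamma>2\<close> for the gradient bound, and with its quadratic term for the
    Laplacian.\<close>
  note CD = CD_zero_Gamma2_ge[OF assms(4,3)]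
  have Gamma2_nonneg: "0 \<le> \<Gamma>2 q f x" for f x
    by (rule order.trans[OF _ CD]) (use assms(3) in simp)
  have "\<Gamma> q u0 x \<le> q_min q / 2" for x
    using le_sup_norm assms(5) by (rule order.trans)
  note bound = is_solution_Gamma_le[OF Gamma2_nonneg q_min_pos[OF assms(2)] this assms(6)]
  fix t :: real and x assume t: "0 < t"
  show "- Laplacian q (u t) x \<le> n / (2 * t)"
    by (rule is_solution_Laplacian_ge[OF CD assms(3) bound assms(6) t])
  \<comment> \<open>\<open>deriv\<close> is two-sided, whereas \<open>is_solution\<close>
    differentiates within \<open>{0..}\<close>; they agree at interior times.\<close>
  have "at t within {0..} = at t"
    using t by (intro at_within_interior) (simp add: interior_Ici[of "t/2"])
  then have "((\<lambda>s. u s x) has_real_derivative Laplacian q (u t) x + \<Gamma> q (u t) x) (at t)"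
    using assms(6) t unfolding is_solution_def by (metis less_imp_le)
  from DERIV_imp_deriv[OF this]
  show "\<Gamma> q (u t) x - deriv (\<lambda>s. u s x) t = - Laplacian q (u t) x"
    by linarith
qed

end
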